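(* For every unfolding angle $\alpha$ with $95.752^\circ \le \alpha \le 95.828^\circ$, the two edges $\overline{P_{18,114167}P_{18,114168}}$ and $\overline{P_{18,179694}P_{18,179695}}$ of the paper-folding polygon $Q_{18}$ with unfolding angle $\alpha$ intersect, i.e. these two closed line segments in the plane have a common point.
   Context: Paper-folding polygons (generalized dragon curves). Fix an unfolding angle $\alpha$ and put $\beta = 90^\circ - \frac{\alpha}{2}$ and $q = \frac{1}{2\cos\beta}$. For $n \in \mathbb{N}_0$ the polygon $Q_n$ is a polygonal path in the plane with $2^n+1$ points $P_{n,k}$, $0\le k\le 2^n$, and edges $\overline{P_{n,k}P_{n,k+1}}$, $0\le k\le 2^n-1$, defined recursively as follows. $Q_0$ is the segment from $P_{0,0}=(0,0)$ to $P_{0,1}=(1,0)$. $Q_{n+1}$ is obtained from $Q_n$ by setting $P_{n+1,2k}=P_{n,k}$ and replacing each directed edge from $P_{n,k}$ to $P_{n,k+1}$ by the two equal sides of an isosceles triangle with base $\overline{P_{n,k}P_{n,k+1}}$, apex $P_{n+1,2k+1}$, apex angle $\alpha$ and base angles $\beta$. The apex lies to the right of the directed edge if $k$ is even, and to the left if $k$ is odd. Equivalently, identifying the plane with $\mathbb{C}$: $P_{n+1,2k+1} = P_{n,k} + q\,e^{-i\beta}(P_{n,k+1}-P_{n,k})$ if $k$ is even, and $P_{n+1,2k+1} = P_{n,k} + q\,e^{i\beta}(P_{n,k+1}-P_{n,k})$ if $k$ is odd. Each edge of $Q_n$ has length $q^n$. *)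

theory Defs
  imports "HOL-Analysis.Analysis"
begin

text \<open>
  The plane is identified with the complex numbers; angles are in radians, so that
  \<open>deg x\<close> is the angle of \<open>x\<close> degrees.
\<close>

definition deg :: "real \<Rightarrow> real" where
  "deg x = x * pi / 180"

definition base_angle :: "real \<Rightarrow> real" where
  "base_angle \<alpha> = deg 90 - \<alpha> / 2"

definition fold_ratio :: "real \<Rightarrow> real" where
  "fold_ratio \<alpha> = 1 / (2 * cos (base_angle \<alpha>))"

text \<open>
  The apex of the isosceles triangle with base from \<open>a\<close> to \<open>b\<close> and apex angle \<open>\<alpha>\<close>,
  to the right or to the left of the directed base. Right of the base means clockwise,
  hence the negative argument.
\<close>

definition apex_right :: "real \<Rightarrow> complex \<Rightarrow> complex \<Rightarrow> complex" where
  "apex_right \<alpha> a b = a + of_real (fold_ratio \<alpha>) * cis (- base_angle \<alpha>) * (b - a)"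

definition apex_left :: "real \<Rightarrow> complex \<Rightarrow> complex \<Rightarrow> complex" where
  "apex_left \<alpha> a b = a + of_real (fold_ratio \<alpha>) * cis (base_angle \<alpha>) * (b - a)"

text \<open>
  \<open>fold_point \<alpha> n k\<close> is the point $P_{n,k}$ of the polygon $Q_n$ with unfolding angle \<open>\<alpha>\<close>.
  Only the values with \<open>k \<le> 2 ^ n\<close> are meaningful.
\<close>

fun fold_point :: "real \<Rightarrow> nat \<Rightarrow> nat \<Rightarrow> complex" where
  "fold_point \<alpha> 0 k = (if k = 0 then 0 else 1)"
| "fold_point \<alpha> (Suc n) m =
     (let k = m div 2; a = fold_point \<alpha> n k; b = fold_point \<alpha> n (Suc k)
      in if even m then a
         else if even k then apex_right \<alpha> a b
         else apex_left \<alpha> a b)"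

definition fold_edge :: "real \<Rightarrow> nat \<Rightarrow> nat \<Rightarrow> complex set" where
  "fold_edge \<alpha> n k = closed_segment (fold_point \<alpha> n k) (fold_point \<alpha> n (Suc k))"

end

theory Submission
  imports Defs
begin

text \<open>
  Let \<open>w = q cis (-\<beta>)\<close>, so that \<open>w + cnj w = 1\<close>; put \<open>s = w * cnj w = q\<^sup>2\<close>. Each step multiplies an
  edge vector by \<open>w\<close> or \<open>cnj w\<close>, and since \<open>w\<^sup>2 = w - s\<close>, every vertex has the form
  \<open>a(s) + b(s) * w\<close> with integer polynomials \<open>a\<close>, \<open>b\<close>. Cramer's rule with respect to the basis
  \<open>1, w\<close> gives the parameters of the crossing point on both edges as rational functions of the single
  real number \<open>s = 1 / (2 * (1 + sin (\<alpha> - pi / 2)))\<close>. On the interval swept out by \<open>s\<close> their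
  numerators, and the differences of denominator and numerator, are monotone, so that it
  suffices to look at the end points.
\<close>

definition rotor :: "real \<Rightarrow> complex" where
  "rotor \<alpha> = of_real (fold_ratio \<alpha>) * cis (- base_angle \<alpha>)"

lemma cnj_rotor: "cnj (rotor \<alpha>) = of_real (fold_ratio \<alpha>) * cis (base_angle \<alpha>)"
  by (simp add: rotor_def cis_cnj)

text \<open>The apex projects to the midpoint of the base, so \<open>rotor \<alpha>\<close> has real
  part 1/2.\<close>

lemma rotor_add_cnj:
  assumes "cos (base_angle \<alpha>) \<noteq> 0"
  shows "rotor \<alpha> + cnj (rotor \<alpha>) = 1"
  using assms by (simp add: rotor_def complex_eq_iff fold_ratio_def field_simps)

lemma rotor_mult_cnj: "rotor \<alpha> * cnj (rotor \<alpha>) = of_real ((fold_ratio \<alpha>)\<^sup>2)"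
  by (simp add: cnj_rotor) (simp add: rotor_def cis_mult power2_eq_square mult_ac)

text \<open>The shifted angle \<open>\<alpha> - pi / 2\<close> is close to 0.1 in the range of
  interest, so that a cubic Taylor polynomial gives sharp enough bounds.\<close>

lemma fold_ratio_square: "(fold_ratio \<alpha>)\<^sup>2 = 1 / (2 * (1 + sin (\<alpha> - pi / 2)))"
proof -
  have "4 * (cos (base_angle \<alpha>))\<^sup>2 = 2 * (1 + cos (2 * base_angle \<alpha>))"
    by (simp add: cos_double_cos)
  also have "2 * base_angle \<alpha> = pi / 2 - (\<alpha> - pi / 2)"
    by (simp add: base_angle_def deg_def)
  finally show ?thesis
    by (simp add: fold_ratio_def power_divide power_mult_distrib cos_sin_eq)
qed

definition fold_vec :: "real \<Rightarrow> nat \<Rightarrow> nat \<Rightarrow> complex" where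
  "fold_vec \<alpha> n k = fold_point \<alpha> n (Suc k) - fold_point \<alpha> n k"

lemma apex_rotor:
  "apex_right \<alpha> a b = a + rotor \<alpha> * (b - a)"
  "apex_left \<alpha> a b = a + cnj (rotor \<alpha>) * (b - a)"
  by (simp_all only: apex_right_def apex_left_def cnj_rotor) (simp add: rotor_def)

lemma fold_point_Suc:
  "fold_point \<alpha> (Suc n) m = fold_point \<alpha> n (m div 2) +
     (if even m then 0
      else (if even (m div 2) then rotor \<alpha> else cnj (rotor \<alpha>)) * fold_vec \<alpha> n (m div 2))"
  by (simp add: Let_def apex_rotor fold_vec_def)

text \<open>The second side of a triangle is the base minus the first side, which turns the factor
  \<open>rotor \<alpha>\<close> into its conjugate and vice versa. Only the index
  \<open>m div 2\<close> occurs on the right, so unfolding follows a single path instead of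
  branching.\<close>

lemma fold_vec_Suc:
  assumes "rotor \<alpha> + cnj (rotor \<alpha>) = 1"
  shows "fold_vec \<alpha> (Suc n) m =
     (if even (m div 2) = even m then rotor \<alpha> else cnj (rotor \<alpha>)) * fold_vec \<alpha> n (m div 2)"
proof -
  have c: "cnj (rotor \<alpha>) = 1 - rotor \<alpha>"
    using assms by (simp add: algebra_simps)
  show ?thesis
  proof (cases "even m")
    case True
    then show ?thesis
      by (auto simp: fold_vec_def[of \<alpha> "Suc n"] fold_point_Suc simp del: fold_point.simps)
  next
    case False
    then have "Suc m div 2 = Suc (m div 2)" by presburger
    with False show ?thesis
      by (auto simp: fold_vec_def fold_point_Suc c algebra_simps simp del: fold_point.simps)
  qed
qed

lemmas fold_point_numeral = fold_point_Suc[of _ "pred_numeral n" for n, folded numeral_eq_Suc]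
lemmas fold_vec_numeral = fold_vec_Suc[of _ "pred_numeral n" for n, folded numeral_eq_Suc]

lemma fold_0: "fold_point \<alpha> 0 0 = 0" "fold_point \<alpha> 0 1 = 1" "fold_vec \<alpha> 0 0 = 1"
  by (simp_all add: fold_vec_def)

text \<open>Since \<open>sin (pi / 6)\<close> is exactly 1/2 and sine is increasing here, it
  suffices to compare Taylor estimates at two rational points with 1/2.\<close>

lemma pi_bounds: "3.14159 < pi" "pi < 3.1416"
proof -
  have sin_half: "sin (pi / 6) = 1 / 2" by (simp add: sin_30)
  have B: "\<bar>sin x - (x - x ^ 3 / 6 + x ^ 5 / 120 - x ^ 7 / 5040)\<bar> \<le> \<bar>x\<bar> ^ 9 / 362880" for x :: real
    using Maclaurin_sin_bound[of x 9]
    by (simp add: sin_coeff_def lessThan_nat_numeral lessThan_Suc fact_numeral algebra_simps)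
  show "3.14159 < pi"
  proof (rule ccontr)
    assume "\<not> ?thesis"
    then have "sin (pi / 6) \<le> sin (3.14159 / 6)"
      using pi_ge_two by (intro sin_monotone_2pi_le) auto
    moreover have "sin (3.14159 / 6 :: real) < 1 / 2"
      using abs_le_D1[OF B[of "3.14159 / 6"]] by (simp add: power_divide)
    ultimately show False using sin_half by simp
  qed
  show "pi < 3.1416"
  proof (rule ccontr)
    assume "\<not> ?thesis"
    then have "sin (3.1416 / 6) \<le> sin (pi / 6)"
      using pi_ge_two by (intro sin_monotone_2pi_le) auto
    moreover have "1 / 2 < sin (3.1416 / 6 :: real)"
      using abs_le_D2[OF B[of "3.1416 / 6"]] by (simp add: power_divide)
    ultimately show False using sin_half by simp
  qed
qed

lemma scale_bounds:
  assumes "deg 95.752 \<le> \<alpha>" "\<alpha> \<le> deg 95.828"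
  shows "0.453908 \<le> (fold_ratio \<alpha>)\<^sup>2" "(fold_ratio \<alpha>)\<^sup>2 \<le> 0.454454"
    "cos (base_angle \<alpha>) \<noteq> 0"
proof -
  define g where "g = \<alpha> - pi / 2"
  have g: "0.100391 \<le> g" "g \<le> 0.101719"
    using assms pi_bounds by (auto simp: g_def deg_def)
  have B: "\<bar>sin x - (x - x ^ 3 / 6)\<bar> \<le> \<bar>x\<bar> ^ 5 / 120" for x :: real
    using Maclaurin_sin_bound[of x 5]
    by (simp add: sin_coeff_def lessThan_nat_numeral lessThan_Suc fact_numeral algebra_simps)
  have "sin 0.100391 \<le> sin g" "sin g \<le> sin 0.101719"
    using g pi_ge_two by (auto intro!: sin_monotone_2pi_le)
  moreover have "0.100222 \<le> sin (0.100391::real)" "sin (0.101719::real) \<le> 0.101544"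
    using abs_le_D2[OF B[of "0.100391"]] abs_le_D1[OF B[of "0.101719"]] by (simp_all add: power_divide)
  ultimately have s: "0.100222 \<le> sin g" "sin g \<le> 0.101544" by linarith+
  then show "0.453908 \<le> (fold_ratio \<alpha>)\<^sup>2" "(fold_ratio \<alpha>)\<^sup>2 \<le> 0.454454"
    by (auto simp: fold_ratio_square field_simps simp flip: g_def)
  \<comment> \<open>A zero cosine would make \<open>fold_ratio \<alpha>\<close> zero, as division by
    zero yields 0, against the lower bound.\<close>
  then show "cos (base_angle \<alpha>) \<noteq> 0"
    by (auto simp: fold_ratio_def)
qed

lemma diff_fold_points:
  fixes w s :: complex
  assumes c: "rotor \<alpha> + cnj (rotor \<alpha>) = 1"
  defines "w \<equiv> rotor \<alpha>" and "s \<equiv> rotor \<alpha> * cnj (rotor \<alpha>)"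
  shows "fold_point \<alpha> 18 179694 - fold_point \<alpha> 18 114167 =
      (1 - 2 * s - 2 * s^4 - s^6 + s^7 - 2 * s^8 + s^9)
      + (- 1 + 2 * s + s^3 + s^5 - 3 * s^6 + 2 * s^7 - s^8) * w" (is ?A)
    "fold_vec \<alpha> 18 114167 = s^7 * ((s^2 - s) + (1 - 2 * s) * w)"
    "fold_vec \<alpha> 18 179694 = s^8 * ((1 - s) - w)"
proof -
  have v: "cnj w = 1 - w"
    unfolding w_def using c by (metis add_diff_cancel_left')
  \<comment> \<open>With \<open>cnj w\<close> and \<open>s\<close> expressed through
    \<open>w\<close>, each claim becomes a polynomial identity in \<open>w\<close> alone.\<close>
  have s: "s = w * (1 - w)" by (simp only: s_def v flip: w_def)
  note vec = fold_vec_numeral[OF c] fold_vec_Suc[OF c]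
  show ?A
    by (simp add: fold_point_numeral fold_point_Suc vec fold_0 del: fold_point.simps flip: w_def,
        simp add: v s, algebra)
  show "fold_vec \<alpha> 18 114167 = s^7 * ((s^2 - s) + (1 - 2 * s) * w)"
    "fold_vec \<alpha> 18 179694 = s^8 * ((1 - s) - w)"
    by (simp_all add: vec fold_0 flip: w_def, simp_all add: v s, algebra+)
qed

text \<open>
  By Cramer's rule the crossing point has parameter \<open>n1 s / (s ^ 6 * m s)\<close> on the first edge and
  \<open>n2 s / (s ^ 8 * m s)\<close> on the second one. The bounds on \<open>s\<close> leave little room: \<open>n1\<close> and
  \<open>s ^ 6 * m s - n1 s\<close> have zeros within \<open>2 / 10 ^ 6\<close> outside of the interval.
\<close>
lemma crossing_numerators:
  fixes s :: real
  assumes s: "0.453908 \<le> s" "s \<le> 0.454454"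
  defines "n1 \<equiv> \<lambda>s::real. - 1 + 2 * s - s^2 + 3 * s^3 - s^4 + 5 * s^5 - 6 * s^6 + 5 * s^7 - 2 * s^8"
    and "n2 \<equiv> \<lambda>s::real. 1 - 5 * s + 7 * s^2 - 2 * s^3 - s^4 + 3 * s^5 - s^7 + s^8 + 2 * s^9 - s^10"
    and "m \<equiv> \<lambda>s::real. (1 - s) * (3 * s - 1)"
  shows "0 \<le> n1 s" "n1 s \<le> s^6 * m s" "0 \<le> n2 s" "n2 s \<le> s^8 * m s"
proof -
  define n1' where "n1' x = 2 - 2 * x + 9 * x^2 - 4 * x^3 + 25 * x^4 - 36 * x^5 + 35 * x^6 - 16 * x^7" for x :: real
  define n2' where "n2' x = - 5 + 14 * x - 6 * x^2 - 4 * x^3 + 15 * x^4 - 7 * x^6 + 8 * x^7 + 18 * x^8 - 10 * x^9" for x :: real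
  define p1 where "p1 x = - 6 * x^5 + 28 * x^6 - 24 * x^7 - n1' x" for x :: real
  define p2 where "p2 x = - 8 * x^7 + 36 * x^8 - 30 * x^9 - n2' x" for x :: real
  have der: "(n1 has_real_derivative n1' x) (at x)" "(n2 has_real_derivative n2' x) (at x)"
    "((\<lambda>x. x^6 * m x - n1 x) has_real_derivative p1 x) (at x)"
    "((\<lambda>x. x^8 * m x - n2 x) has_real_derivative p2 x) (at x)" for x
    unfolding n1_def n2_def m_def n1'_def n2'_def p1_def p2_def
    by (auto intro!: derivative_eq_intros simp: algebra_simps eval_nat_numeral)
  have sign: "0 \<le> n1' x" "0 \<le> n2' x" "p1 x \<le> 0" "p2 x \<le> 0"
    if x: "0.453908 \<le> x" "x \<le> 0.454454" for x
  proof -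
    \<comment> \<open>With each power enclosed separately, the sign conditions are linear in the
      powers of \<open>x\<close>.\<close>
    have P: "0.453908 ^ k \<le> x ^ k \<and> x ^ k \<le> 0.454454 ^ k" for k
      using x by (auto intro: power_mono)
    show "0 \<le> n1' x" "0 \<le> n2' x" "p1 x \<le> 0" "p2 x \<le> 0"
      unfolding n1'_def n2'_def p1_def p2_def
      using x P[of 2] P[of 3] P[of 4] P[of 5] P[of 6] P[of 7] P[of 8] P[of 9]
      by (simp_all add: power_divide)
  qed
  have "n1 0.453908 \<le> n1 s" "n2 0.453908 \<le> n2 s"
    using DERIV_nonneg_imp_nondecreasing[of "0.453908" s n1]
      DERIV_nonneg_imp_nondecreasing[of "0.453908" s n2] der sign s
    by (meson order_trans)+
  moreover have "s^6 * m s - n1 s \<ge> 0.454454^6 * m 0.454454 - n1 0.454454"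
    "s^8 * m s - n2 s \<ge> 0.454454^8 * m 0.454454 - n2 0.454454"
    using DERIV_nonpos_imp_nonincreasing[of s "0.454454" "\<lambda>x. x^6 * m x - n1 x"]
      DERIV_nonpos_imp_nonincreasing[of s "0.454454" "\<lambda>x. x^8 * m x - n2 x"] der sign s
    by (meson order_trans)+
  moreover have "0 \<le> n1 0.453908" "0 \<le> n2 0.453908"
    "0 \<le> 0.454454^6 * m 0.454454 - n1 0.454454"
    "0 \<le> 0.454454^8 * m 0.454454 - n2 0.454454"
    by (simp_all add: n1_def n2_def m_def power_divide)
  ultimately show "0 \<le> n1 s" "n1 s \<le> s^6 * m s" "0 \<le> n2 s" "n2 s \<le> s^8 * m s"
    by linarith+
qed

lemma fold_edge_eq: "fold_edge \<alpha> n k = {fold_point \<alpha> n k + of_real u * fold_vec \<alpha> n k | u. 0 \<le> u \<and> u \<le> 1}"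
  by (auto simp: fold_edge_def closed_segment_def fold_vec_def scaleR_conv_of_real algebra_simps)

theorem theorem1:
  fixes \<alpha> :: real
  assumes "deg 95.752 \<le> \<alpha>" and "\<alpha> \<le> deg 95.828"
  shows "fold_edge \<alpha> 18 114167 \<inter> fold_edge \<alpha> 18 179694 \<noteq> {}"
proof -
  define s where "s = (fold_ratio \<alpha>)\<^sup>2"
  define w where "w = rotor \<alpha>"
  \<comment> \<open>The determinant of the two edge vectors in the basis 1, \<open>w\<close> is
    \<open>s ^ 15 * m\<close> up to sign; Cramer's rule yields \<open>x\<close> and
    \<open>y\<close>.\<close>
  define m where "m = (1 - s) * (3 * s - 1)"
  define n1 where "n1 = - 1 + 2 * s - s^2 + 3 * s^3 - s^4 + 5 * s^5 - 6 * s^6 + 5 * s^7 - 2 * s^8"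
  define n2 where "n2 = 1 - 5 * s + 7 * s^2 - 2 * s^3 - s^4 + 3 * s^5 - s^7 + s^8 + 2 * s^9 - s^10"
  define x where "x = n1 / (s^6 * m)"
  define y where "y = n2 / (s^8 * m)"
  have s: "0.453908 \<le> s" "s \<le> 0.454454" and "rotor \<alpha> + cnj (rotor \<alpha>) = 1"
    using scale_bounds[OF assms] by (auto simp: s_def intro: rotor_add_cnj)
  note diff = diff_fold_points[OF this(3), unfolded rotor_mult_cnj, folded s_def w_def]
  have pos: "0 < m" "0 < s" using s by (auto simp: m_def)
  have x: "0 \<le> x" "x \<le> 1" and y: "0 \<le> y" "y \<le> 1"
    using crossing_numerators[OF s] pos by (auto simp: x_def y_def n1_def n2_def m_def)
  have xm: "s^6 * x = n1 / m" and ym: "s^8 * y = n2 / m"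
    using pos by (auto simp: x_def y_def)
  \<comment> \<open>The coefficients of 1 and of \<open>w\<close> in the vector equation are checked
    in turn; after clearing \<open>m\<close>, each is a polynomial identity in
    \<open>s\<close>.\<close>
  have "x * (s^7 * (s^2 - s)) - y * (s^8 * (1 - s))
      = (s^6 * x) * (s * (s^2 - s)) - (s^8 * y) * (1 - s)"
    by (simp add: algebra_simps eval_nat_numeral)
  also have "\<dots> = (n1 * (s * (s^2 - s)) - n2 * (1 - s)) / m"
    unfolding xm ym by (simp add: add_divide_distrib diff_divide_distrib)
  also have "\<dots> = 1 - 2 * s - 2 * s^4 - s^6 + s^7 - 2 * s^8 + s^9"
  proof -
    have "n1 * (s * (s^2 - s)) - n2 * (1 - s) = (1 - 2 * s - 2 * s^4 - s^6 + s^7 - 2 * s^8 + s^9) * m"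
      unfolding n1_def n2_def m_def by algebra
    then show ?thesis using pos by simp
  qed
  finally have c0: "x * (s^7 * (s^2 - s)) - y * (s^8 * (1 - s)) = \<dots>" .
  have "x * (s^7 * (1 - 2 * s)) + y * s^8 = (s^6 * x) * (s * (1 - 2 * s)) + s^8 * y"
    by (simp add: algebra_simps eval_nat_numeral)
  also have "\<dots> = (n1 * (s * (1 - 2 * s)) + n2) / m"
    unfolding xm ym by (simp add: add_divide_distrib diff_divide_distrib)
  also have "\<dots> = - 1 + 2 * s + s^3 + s^5 - 3 * s^6 + 2 * s^7 - s^8"
  proof -
    have "n1 * (s * (1 - 2 * s)) + n2 = (- 1 + 2 * s + s^3 + s^5 - 3 * s^6 + 2 * s^7 - s^8) * m"
      unfolding n1_def n2_def m_def by algebra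
    then show ?thesis using pos by simp
  qed
  finally have c1: "x * (s^7 * (1 - 2 * s)) + y * s^8 = \<dots>" .
  have "fold_point \<alpha> 18 179694 - fold_point \<alpha> 18 114167
      = of_real (x * (s^7 * (s^2 - s)) - y * (s^8 * (1 - s)))
        + of_real (x * (s^7 * (1 - 2 * s)) + y * s^8) * w"
    unfolding c0 c1 diff by simp
  also have "\<dots> = of_real x * fold_vec \<alpha> 18 114167 - of_real y * fold_vec \<alpha> 18 179694"
    unfolding diff by (simp add: algebra_simps)
  finally have "fold_point \<alpha> 18 114167 + of_real x * fold_vec \<alpha> 18 114167
      = fold_point \<alpha> 18 179694 + of_real y * fold_vec \<alpha> 18 179694"
    by (simp add: algebra_simps del: fold_point.simps)
  then show ?thesis
    unfolding fold_edge_eq using x y by blast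
qed

end
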